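(* Let $H$ be an additive subgroup of the rational numbers $(\mathbb Q, +)$ and let $K$ be a semigroup. If the semigroups $\mathcal P_{\mathrm{fin}}(H)$ and $\mathcal P_{\mathrm{fin}}(K)$ are isomorphic, then $H$ and $K$ are isomorphic (as semigroups).
   Context: For a semigroup $S$, the finitary power semigroup $\mathcal P_{\mathrm{fin}}(S)$ is the semigroup whose elements are all non-empty finite subsets of $S$, with the setwise operation induced by $S$: $AB := \{ab : a \in A,\, b \in B\}$, which is the sumset $A + B := \{a+b : a \in A,\, b \in B\}$ if $S$ is written additively. All isomorphisms are semigroup isomorphisms. *)

theory Defs
  imports Complex_Main "HOL-Algebra.Coset"
begin

text \<open>
  Semigroups are given by a carrier and a multiplication. They reuse the record
  type of monoids so that \<^const>\<open>hom\<close>, \<^const>\<open>iso\<close> and \<^const>\<open>is_iso\<close> apply: these only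
  refer to the carrier and the multiplication, hence are the semigroup notions. The field
  \<^const>\<open>one\<close> is unconstrained and plays no role.
\<close>

locale alg_semigroup =
  fixes S (structure)
  assumes m_closed: "\<lbrakk>x \<in> carrier S; y \<in> carrier S\<rbrakk> \<Longrightarrow> x \<otimes> y \<in> carrier S"
    and m_assoc: "\<lbrakk>x \<in> carrier S; y \<in> carrier S; z \<in> carrier S\<rbrakk> \<Longrightarrow>
      (x \<otimes> y) \<otimes> z = x \<otimes> (y \<otimes> z)"

text \<open>
  The unit component is \<open>{\<one>\<^bsub>S\<^esub>}\<close>, which is the identity if \<open>S\<close> is a monoid and is
  meaningless otherwise.
\<close>

definition fin_power_semigroup :: "('a, 'b) monoid_scheme \<Rightarrow> 'a set monoid" where
  "fin_power_semigroup S =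
    \<lparr>carrier = {A. A \<subseteq> carrier S \<and> finite A \<and> A \<noteq> {}},
     monoid.mult = (\<lambda>A B. A <#>\<^bsub>S\<^esub> B),
     one = {\<one>\<^bsub>S\<^esub>}\<rparr>"

definition rat_group :: "rat monoid" where
  "rat_group = \<lparr>carrier = UNIV, monoid.mult = (+), one = 0\<rparr>"

lemma group_rat_group: "group rat_group"
  by (rule groupI) (auto simp: rat_group_def add.assoc intro: exI [of _ "- x" for x])

lemma alg_semigroup_fin_power_semigroup:
  assumes "alg_semigroup S"
  shows "alg_semigroup (fin_power_semigroup S)"
proof -
  interpret alg_semigroup S by fact
  show ?thesis
  proof
    fix A B
    assume "A \<in> carrier (fin_power_semigroup S)" "B \<in> carrier (fin_power_semigroup S)"
    then show "A \<otimes>\<^bsub>fin_power_semigroup S\<^esub> B \<in> carrier (fin_power_semigroup S)"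
      by (auto simp: fin_power_semigroup_def set_mult_def intro: m_closed)
  next
    fix A B C
    assume "A \<in> carrier (fin_power_semigroup S)" "B \<in> carrier (fin_power_semigroup S)"
      "C \<in> carrier (fin_power_semigroup S)"
    then have sub: "A \<subseteq> carrier S" "B \<subseteq> carrier S" "C \<subseteq> carrier S"
      by (auto simp: fin_power_semigroup_def)
    have "(\<Union>x\<in>A. \<Union>y\<in>B. \<Union>z\<in>C. {(x \<otimes>\<^bsub>S\<^esub> y) \<otimes>\<^bsub>S\<^esub> z}) =
      (\<Union>x\<in>A. \<Union>y\<in>B. \<Union>z\<in>C. {x \<otimes>\<^bsub>S\<^esub> (y \<otimes>\<^bsub>S\<^esub> z)})"
      using sub by (intro SUP_cong refl) (simp add: m_assoc subset_iff)
    then show "(A \<otimes>\<^bsub>fin_power_semigroup S\<^esub> B) \<otimes>\<^bsub>fin_power_semigroup S\<^esub> C =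
      A \<otimes>\<^bsub>fin_power_semigroup S\<^esub> (B \<otimes>\<^bsub>fin_power_semigroup S\<^esub> C)"
      by (simp add: fin_power_semigroup_def set_mult_def)
  qed
qed

end

theory Submission
  imports Defs "HOL-Library.Set_Algebras"
begin

text \<open>
  Two finite sets of rationals with the same minimum and maximum become equal after adding a
  suitable finite set, so a homomorphism from \<open>\<P>\<^sub>f\<^sub>i\<^sub>n(H)\<close> to \<open>\<rat>\<close> only depends on minimum and
  maximum. If it vanishes on singletons, it is a multiple of the width \<open>max - min\<close>; hence if it
  vanishes on one more set, it is zero. Now let \<open>\<psi>\<close> be an isomorphism from \<open>\<P>\<^sub>f\<^sub>i\<^sub>n(H)\<close> to
  \<open>\<P>\<^sub>f\<^sub>i\<^sub>n(K)\<close>. Invertibility shows that \<open>\<psi>\<close> maps singletons to singletons. For \<open>x\<close> in \<open>K\<close> put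
  \<open>\<mu>(x) = min (\<psi>\<inverse>{x})\<close>. This is additive, so \<open>X \<mapsto> max \<mu>(X) - min \<mu>(X)\<close> is a homomorphism on
  \<open>\<P>\<^sub>f\<^sub>i\<^sub>n(K)\<close> that vanishes on all singletons of \<open>K\<close>. If some \<open>\<psi>\<inverse>{x}\<close> were not a singleton, this
  homomorphism would be zero; but it takes the value \<open>\<bar>h\<bar>\<close> on \<open>\<psi>{0} \<union> \<psi>{h}\<close>.
\<close>

section \<open>Extrema of sumsets and bounded denominators\<close>

lemma Max_set_plus:
  fixes A B :: "'a::linordered_ab_group_add set"
  assumes "finite A" "A \<noteq> {}" "finite B" "B \<noteq> {}"
  shows "Max (A + B) = Max A + Max B"
proof (rule Max_eqI)
  show "finite (A + B)"
    using assms by (simp add: finite_set_plus)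
  show "y \<le> Max A + Max B" if "y \<in> A + B" for y
    using that assms by (auto elim!: set_plus_elim intro!: add_mono)
  show "Max A + Max B \<in> A + B"
    using assms by (intro set_plus_intro) auto
qed

lemma Min_set_plus:
  fixes A B :: "'a::linordered_ab_group_add set"
  assumes "finite A" "A \<noteq> {}" "finite B" "B \<noteq> {}"
  shows "Min (A + B) = Min A + Min B"
proof (rule Min_eqI)
  show "finite (A + B)"
    using assms by (simp add: finite_set_plus)
  show "y \<ge> Min A + Min B" if "y \<in> A + B" for y
    using that assms by (auto elim!: set_plus_elim intro!: add_mono)
  show "Min A + Min B \<in> A + B"
    using assms by (intro set_plus_intro) auto
qed

lemma common_denominator:
  fixes A :: "rat set"
  assumes "finite A"
  shows "\<exists>q::int. q > 0 \<and> (\<forall>a\<in>A. of_int q * a \<in> \<int>)"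
  using assms
proof (induction A rule: finite_induct)
  case empty
  show ?case by (intro exI[of _ 1]) auto
next
  case (insert x A)
  then obtain q :: int where q: "q > 0" "\<And>a. a \<in> A \<Longrightarrow> of_int q * a \<in> \<int>"
    by blast
  obtain n d where x: "x = of_int n / of_int d" "d > 0"
    by (cases x) (auto simp: Fract_of_int_quotient)
  have "of_int (q * d) * x = of_int (q * n)"
    using x by simp
  then have "of_int (q * d) * x \<in> \<int>"
    by (metis Ints_of_int)
  moreover have "of_int (q * d) * a \<in> \<int>" if "a \<in> A" for a
  proof -
    have "of_int (q * d) * a = of_int d * (of_int q * a)"
      by simp
    then show ?thesis
      using q(2)[OF that] by (metis Ints_mult Ints_of_int)
  qed
  ultimately show ?case
    using q x by (intro exI[of _ "q * d"]) auto
qed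

text \<open>Intervals of rationals are infinite in general; once \<open>q * x\<close> is integral,
  only the values \<open>k / q\<close> with \<open>k\<close> in a finite range of integers
  remain.\<close>

lemma finite_bounded_denominator:
  fixes l u :: rat and q :: int
  assumes "q > 0"
  shows "finite {x. of_int q * x \<in> \<int> \<and> l \<le> x \<and> x \<le> u}" (is "finite ?S")
proof -
  have "?S \<subseteq> (\<lambda>k. of_int k / of_int q) ` {\<lfloor>of_int q * l\<rfloor>..\<lceil>of_int q * u\<rceil>}"
  proof
    fix x assume "x \<in> ?S"
    then obtain k where k: "of_int q * x = of_int k" and x: "l \<le> x" "x \<le> u"
      by (auto elim: Ints_cases)
    have "of_int q * l \<le> of_int k" "of_int k \<le> of_int q * u"
      using x assms by (auto simp flip: k)
    then have "k \<in> {\<lfloor>of_int q * l\<rfloor>..\<lceil>of_int q * u\<rceil>}"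
      by (auto simp: floor_le_iff le_ceiling_iff)
    moreover have "x = of_int k / of_int q"
      using k assms by (simp add: field_simps)
    ultimately show "x \<in> (\<lambda>k. of_int k / of_int q) ` {\<lfloor>of_int q * l\<rfloor>..\<lceil>of_int q * u\<rceil>}"
      by blast
  qed
  then show ?thesis
    by (rule finite_subset) simp
qed

section \<open>Additive functions on finite subsets of a subgroup of the rationals\<close>

locale rat_subgroup =
  fixes H :: "rat set"
  assumes zero_closed: "0 \<in> H"
    and add_closed: "\<lbrakk>x \<in> H; y \<in> H\<rbrakk> \<Longrightarrow> x + y \<in> H"
    and minus_closed: "x \<in> H \<Longrightarrow> - x \<in> H"
begin

lemma diff_closed: "\<lbrakk>x \<in> H; y \<in> H\<rbrakk> \<Longrightarrow> x - y \<in> H"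
  using add_closed[of x "- y"] minus_closed by simp

definition Pfin :: "rat set set" where
  "Pfin = {A. A \<subseteq> H \<and> finite A \<and> A \<noteq> {}}"

lemma Pfin_singleton: "h \<in> H \<Longrightarrow> {h} \<in> Pfin"
  by (simp add: Pfin_def)

lemma Pfin_plus: "\<lbrakk>A \<in> Pfin; B \<in> Pfin\<rbrakk> \<Longrightarrow> A + B \<in> Pfin"
  by (auto simp: Pfin_def finite_set_plus set_plus_def intro: add_closed)

text \<open>
  With \<open>m\<close> the width of \<open>A\<close> and \<open>C\<close> the elements of \<open>H\<close> in \<open>[0, m]\<close> with bounded denominator,
  already \<open>{Min A, Max A} + C\<close> exhausts the elements of \<open>H\<close> in \<open>[Min A, Max A + m]\<close> with bounded
  denominator.
\<close>

lemma plus_stabilizes: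
  assumes A: "A \<in> Pfin" and B: "B \<in> Pfin"
    and Min: "Min A = Min B" and Max: "Max A = Max B"
  shows "\<exists>C\<in>Pfin. A + C = B + C"
proof -
  obtain q :: int where q: "q > 0" and qAB: "\<And>a. a \<in> A \<union> B \<Longrightarrow> of_int q * a \<in> \<int>"
    using common_denominator[of "A \<union> B"] A B by (auto simp: Pfin_def)
  define m where "m = Max A - Min A"
  define C where "C = {x \<in> H. of_int q * x \<in> \<int> \<and> 0 \<le> x \<and> x \<le> m}"
  define D where "D = {x \<in> H. of_int q * x \<in> \<int> \<and> Min A \<le> x \<and> x \<le> Max A + m}"
  have m: "m \<ge> 0"
    using A by (auto simp: m_def Pfin_def)
  \<comment> \<open>Covering \<open>D\<close> uses only the two endpoints of \<open>E\<close>, so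
    \<open>A\<close> and \<open>B\<close> yield the same sumset.\<close>
  have eq: "E + C = D"
    if E: "E \<in> Pfin" "E \<subseteq> A \<union> B" "Min E = Min A" "Max E = Max A" for E
  proof
    have mem: "Min A \<in> E" "Max A \<in> E" "E \<subseteq> H"
      using E Min_in[of E] Max_in[of E] by (auto simp: Pfin_def)
    show "E + C \<subseteq> D"
    proof
      fix x assume "x \<in> E + C"
      then obtain a c where x: "x = a + c" and a: "a \<in> E" and c: "c \<in> C"
        by (auto elim: set_plus_elim)
      have "Min A \<le> a" "a \<le> Max A"
        using a E by (auto simp: Pfin_def simp flip: E(3,4))
      moreover have "of_int q * a \<in> \<int>" "a \<in> H"
        using a E mem qAB by auto
      ultimately show "x \<in> D"
        using c unfolding x C_def D_def by (auto simp: ring_distribs intro: add_closed)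
    qed
    show "D \<subseteq> E + C"
    proof
      fix x assume x: "x \<in> D"
      have int: "of_int q * Min A \<in> \<int>" "of_int q * Max A \<in> \<int>"
        using mem E(2) qAB by auto
      show "x \<in> E + C"
      proof (cases "x \<le> Max A")
        case True
        then have "x - Min A \<in> C"
          using x mem int by (auto simp: C_def D_def m_def ring_distribs intro!: diff_closed)
        then show ?thesis
          using set_plus_intro[OF mem(1)] by fastforce
      next
        case False
        then have "x - Max A \<in> C"
          using x mem int by (auto simp: C_def D_def ring_distribs intro!: diff_closed)
        then show ?thesis
          using set_plus_intro[OF mem(2)] by fastforce
      qed
    qed
  qed
  have "C \<in> Pfin"
  proof -
    have "finite C"
      by (rule finite_subset[OF _ finite_bounded_denominator[OF q, of 0 m]]) (auto simp: C_def)
    moreover have "0 \<in> C"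
      using zero_closed m by (simp add: C_def)
    ultimately show ?thesis
      by (auto simp: Pfin_def C_def)
  qed
  moreover have "A + C = B + C"
    using eq[of A] eq[of B] A B Min Max by simp
  ultimately show ?thesis ..
qed

text \<open>With the stabilizing set \<open>C\<close> one gets \<open>f A + f C = f B + f C\<close>,
  and \<open>f C\<close> cancels in the rationals.\<close>

lemma additive_eq_if_Min_Max_eq:
  fixes f :: "rat set \<Rightarrow> rat"
  assumes f: "\<And>A B. \<lbrakk>A \<in> Pfin; B \<in> Pfin\<rbrakk> \<Longrightarrow> f (A + B) = f A + f B"
    and "A \<in> Pfin" "B \<in> Pfin" "Min A = Min B" "Max A = Max B"
  shows "f A = f B"
proof -
  obtain C where C: "C \<in> Pfin" "A + C = B + C"
    using plus_stabilizes assms by blast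
  then show ?thesis
    using f[of A C] f[of B C] assms by simp
qed

text \<open>The sumset of \<open>Suc n\<close> copies of \<open>A\<close> works, as minimum, maximum
  and \<open>f\<close> are all additive.\<close>

lemma ex_multiple:
  fixes f :: "rat set \<Rightarrow> rat"
  assumes f: "\<And>A B. \<lbrakk>A \<in> Pfin; B \<in> Pfin\<rbrakk> \<Longrightarrow> f (A + B) = f A + f B"
    and A: "A \<in> Pfin"
  shows "\<exists>B\<in>Pfin. Min B = of_nat (Suc n) * Min A \<and> Max B = of_nat (Suc n) * Max A \<and>
    f B = of_nat (Suc n) * f A"
proof (induction n)
  case 0
  show ?case using A by auto
next
  case (Suc n)
  then obtain B where B: "B \<in> Pfin" "Min B = of_nat (Suc n) * Min A"
    "Max B = of_nat (Suc n) * Max A" "f B = of_nat (Suc n) * f A"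
    by blast
  then show ?case
    using A f[of A B]
    by (intro bexI[of _ "A + B"] Pfin_plus)
      (auto simp: Min_set_plus Max_set_plus Pfin_def algebra_simps)
qed

text \<open>Two positive rational widths are commensurable, so suitable iterated sumsets of
  \<open>A\<close> and \<open>B\<close> have equal width; up to a translation, \<open>f\<close>
  cannot tell them apart.\<close>

lemma additive_eq_zero:
  fixes f :: "rat set \<Rightarrow> rat"
  assumes f: "\<And>A B. \<lbrakk>A \<in> Pfin; B \<in> Pfin\<rbrakk> \<Longrightarrow> f (A + B) = f A + f B"
    and f0: "\<And>h. h \<in> H \<Longrightarrow> f {h} = 0"
    and A: "A \<in> Pfin" "Min A < Max A" "f A = 0"
    and B: "B \<in> Pfin" "Min B < Max B"
  shows "f B = 0"
proof -
  \<comment> \<open>The ratio dictates the numbers of copies: \<open>s\<close> of \<open>A\<close>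
    and \<open>r\<close> of \<open>B\<close> have the same width.\<close>
  obtain r s where rs: "(Max A - Min A) / (Max B - Min B) = of_int r / of_int s" "s > 0"
    by (metis Fract_of_int_quotient Rat_cases)
  have "(Max A - Min A) / (Max B - Min B) > 0"
    using A B by simp
  then have r: "r > 0"
    using rs by (simp add: zero_less_divide_iff)
  obtain i j where ij: "r = int (Suc i)" "s = int (Suc j)"
    using r rs(2) by (metis gr0_implies_Suc pos_int_cases)
  have width: "of_nat (Suc j) * (Max A - Min A) = of_nat (Suc i) * (Max B - Min B)"
    using rs B unfolding ij by (simp add: field_simps del: of_nat_Suc)
  obtain A' where A': "A' \<in> Pfin" "Min A' = of_nat (Suc j) * Min A"
    "Max A' = of_nat (Suc j) * Max A" "f A' = of_nat (Suc j) * f A"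
    using ex_multiple[of f, OF f A(1)] by blast
  obtain B' where B': "B' \<in> Pfin" "Min B' = of_nat (Suc i) * Min B"
    "Max B' = of_nat (Suc i) * Max B" "f B' = of_nat (Suc i) * f B"
    using ex_multiple[of f, OF f B(1)] by blast
  \<comment> \<open>The shift that moves the minimum of \<open>B'\<close> to that of
    \<open>A'\<close>. Both minima lie in \<open>H\<close>, so \<open>f {t} = 0\<close>.\<close>
  define t where "t = Min A' - Min B'"
  have t: "t \<in> H"
    using A'(1) B'(1) Min_in[of A'] Min_in[of B'] unfolding t_def Pfin_def
    by (intro diff_closed) blast+
  have "Max A' - Min A' = Max B' - Min B'"
    using width by (simp add: A' B' right_diff_distrib del: of_nat_Suc)
  then have "Min A' = Min (B' + {t})" "Max A' = Max (B' + {t})"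
    using B'(1) by (simp_all add: Min_set_plus Max_set_plus Pfin_def t_def)
  then have "f A' = f (B' + {t})"
    using additive_eq_if_Min_Max_eq[of f A' "B' + {t}"] f A'(1)
      Pfin_plus[OF B'(1) Pfin_singleton[OF t]] by blast
  also have "\<dots> = f B'"
    using f[OF B'(1) Pfin_singleton[OF t]] f0[OF t] by simp
  finally have "of_nat (Suc i) * f B = 0"
    using A' B' A(3) by (simp del: of_nat_Suc)
  then show ?thesis
    by (simp del: of_nat_Suc)
qed

end

section \<open>Images of singletons under the isomorphism\<close>

locale fin_power_iso = rat_subgroup H + alg_semigroup K
  for H and K (structure) +
  fixes \<psi>
  assumes bij: "bij_betw \<psi> Pfin (carrier (fin_power_semigroup K))"
    and psi_plus: "\<lbrakk>A \<in> Pfin; B \<in> Pfin\<rbrakk> \<Longrightarrow> \<psi> (A + B) = \<psi> A <#> \<psi> B"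
begin

lemma psi_closed:
  assumes "A \<in> Pfin"
  shows "\<psi> A \<subseteq> carrier K" "finite (\<psi> A)" "\<psi> A \<noteq> {}"
  using bij_betwE[OF bij] assms by (auto simp: fin_power_semigroup_def)

lemma psi_inj: "\<lbrakk>A \<in> Pfin; B \<in> Pfin; \<psi> A = \<psi> B\<rbrakk> \<Longrightarrow> A = B"
  using bij by (auto simp: bij_betw_def inj_on_def)

lemma psi_surj:
  assumes "X \<subseteq> carrier K" "finite X" "X \<noteq> {}"
  obtains A where "A \<in> Pfin" "\<psi> A = X"
proof -
  have "X \<in> \<psi> ` Pfin"
    using bij assms by (auto simp: bij_betw_def fin_power_semigroup_def)
  then show ?thesis
    using that by blast
qed

text \<open>Singletons of \<open>K\<close> are images of finite sets of rationals, whose sumsets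
  commute.\<close>

lemma m_comm:
  assumes "x \<in> carrier K" "y \<in> carrier K"
  shows "x \<otimes> y = y \<otimes> x"
proof -
  obtain A where "A \<in> Pfin" "\<psi> A = {x}"
    using psi_surj[of "{x}"] assms by auto
  moreover obtain B where "B \<in> Pfin" "\<psi> B = {y}"
    using psi_surj[of "{y}"] assms by auto
  ultimately have "{x} <#> {y} = {y} <#> {x}"
    using psi_plus[of A B] psi_plus[of B A] by (simp add: add.commute)
  then show ?thesis
    by (simp add: set_mult_def)
qed

text \<open>\<open>{0}\<close> is neutral in \<open>Pfin\<close>, so \<open>\<psi> {0}\<close> fixes
  every \<open>{x}\<close>. This supplies the semigroup \<open>K\<close> with a unit.\<close>

lemma psi_zero_left_neutral:
  assumes e: "e \<in> \<psi> {0}" and x: "x \<in> carrier K"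
  shows "e \<otimes> x = x"
proof -
  obtain A where A: "A \<in> Pfin" "\<psi> A = {x}"
    using psi_surj[of "{x}"] x by auto
  then have "\<psi> {0} <#> {x} = {x}"
    using psi_plus[OF Pfin_singleton[OF zero_closed] A(1)]
    by (simp add: set_zero)
  then show ?thesis
    using e by (auto simp: set_mult_def)
qed

text \<open>Products of elements of \<open>\<psi> {h}\<close> and \<open>\<psi> {- h}\<close> are
  neutral, so all elements of \<open>\<psi> {h}\<close> are inverse to one fixed \<open>b\<close>,
  and inverses are unique.\<close>

lemma psi_singleton:
  assumes h: "h \<in> H"
  shows "\<exists>x\<in>carrier K. \<psi> {h} = {x}"
proof -
  note P = Pfin_singleton[OF h] Pfin_singleton[OF minus_closed[OF h]]
  have prod: "\<psi> {h} <#> \<psi> {- h} = \<psi> {0}"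
    using psi_plus[OF P] by (simp add: set_plus_def)
  obtain b where b: "b \<in> \<psi> {- h}"
    using psi_closed[OF P(2)] by blast
  then have bK: "b \<in> carrier K"
    using psi_closed[OF P(2)] by blast
  have eq: "a = a'" if "a \<in> \<psi> {h}" "a' \<in> \<psi> {h}" for a a'
  proof -
    have K: "a \<in> carrier K" "a' \<in> carrier K"
      using that psi_closed[OF P(1)] by auto
    have e: "a \<otimes> b \<in> \<psi> {0}" "a' \<otimes> b \<in> \<psi> {0}"
      using that b by (auto simp: set_mult_def simp flip: prod)
    \<comment> \<open>Commutativity lets \<open>a\<close> and \<open>a'\<close> trade places, and
      the bracketed factor is neutral before and after.\<close>
    have "a' = (a \<otimes> b) \<otimes> a'"
      using psi_zero_left_neutral[OF e(1) K(2)] by simp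
    also have "\<dots> = (a' \<otimes> b) \<otimes> a"
      using K bK by (metis m_assoc m_comm m_closed)
    also have "\<dots> = a"
      using psi_zero_left_neutral[OF e(2) K(1)] .
    finally show ?thesis by simp
  qed
  obtain x where "x \<in> \<psi> {h}"
    using psi_closed[OF P(1)] by blast
  moreover from this eq have "\<psi> {h} = {x}"
    by blast
  ultimately show ?thesis
    using psi_closed[OF P(1)] by blast
qed

section \<open>Preimages of points of \<open>K\<close> and the spread functional\<close>

definition preimage :: "'a \<Rightarrow> rat set" where
  "preimage x = the_inv_into Pfin \<psi> {x}"

lemma preimage_props:
  assumes "x \<in> carrier K"
  shows "preimage x \<in> Pfin" "\<psi> (preimage x) = {x}"
proof -
  obtain A where "A \<in> Pfin" "\<psi> A = {x}"
    using psi_surj[of "{x}"] assms by auto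
  then show "preimage x \<in> Pfin" "\<psi> (preimage x) = {x}"
    using bij unfolding preimage_def bij_betw_def by (metis the_inv_into_f_f)+
qed

lemma preimage_eqI: "\<lbrakk>A \<in> Pfin; \<psi> A = {x}\<rbrakk> \<Longrightarrow> preimage x = A"
  using bij unfolding preimage_def bij_betw_def by (metis the_inv_into_f_f)

lemma preimage_mult:
  assumes "x \<in> carrier K" "y \<in> carrier K"
  shows "preimage (x \<otimes> y) = preimage x + preimage y"
proof (rule preimage_eqI)
  show "preimage x + preimage y \<in> Pfin"
    by (intro Pfin_plus preimage_props assms)
  show "\<psi> (preimage x + preimage y) = {x \<otimes> y}"
    using assms by (simp add: psi_plus preimage_props set_mult_def)
qed

text \<open>\<open>preimage x\<close> is not yet known to be a singleton. Its minimum selects a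
  point of \<open>H\<close> in an additive way.\<close>

definition mu :: "'a \<Rightarrow> rat" where
  "mu x = Min (preimage x)"

lemma mu_mult:
  assumes "x \<in> carrier K" "y \<in> carrier K"
  shows "mu (x \<otimes> y) = mu x + mu y"
  using preimage_props(1)[OF assms(1)] preimage_props(1)[OF assms(2)]
  by (simp add: mu_def preimage_mult assms Min_set_plus Pfin_def)

lemma mu_image_mult:
  assumes "X \<subseteq> carrier K" "Y \<subseteq> carrier K"
  shows "mu ` (X <#> Y) = mu ` X + mu ` Y"
proof -
  have "mu ` (X <#> Y) = (\<Union>x\<in>X. \<Union>y\<in>Y. {mu (x \<otimes> y)})"
    by (auto simp: set_mult_def)
  also have "\<dots> = (\<Union>x\<in>X. \<Union>y\<in>Y. {mu x + mu y})"
    using assms by (intro SUP_cong refl) (simp add: mu_mult subset_iff)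
  also have "\<dots> = mu ` X + mu ` Y"
    by (auto simp: set_plus_def)
  finally show ?thesis .
qed

text \<open>Pulled back along \<open>\<psi>\<close> to subsets of \<open>H\<close>, so that
  \<open>additive_eq_zero\<close> applies.\<close>

definition spread :: "rat set \<Rightarrow> rat" where
  "spread A = Max (mu ` \<psi> A) - Min (mu ` \<psi> A)"

lemma spread_plus:
  assumes "A \<in> Pfin" "B \<in> Pfin"
  shows "spread (A + B) = spread A + spread B"
  using psi_closed[OF assms(1)] psi_closed[OF assms(2)]
  by (simp add: spread_def psi_plus assms mu_image_mult Max_set_plus Min_set_plus)

lemma spread_eq_zero: "\<psi> A = {x} \<Longrightarrow> spread A = 0"
  by (simp add: spread_def)

text \<open>If \<open>preimage x\<close> had positive width, then \<open>spread\<close>, being zero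
  there and on singletons of \<open>H\<close>, would vanish on every set of positive width; the
  preimage of \<open>{e, u}\<close> contradicts this.\<close>

lemma preimage_singleton:
  assumes x: "x \<in> carrier K"
  shows "\<exists>h\<in>H. preimage x = {h}"
proof -
  let ?A = "preimage x"
  have A: "?A \<in> Pfin" "\<psi> ?A = {x}"
    using preimage_props x by auto
  have A': "finite ?A" "?A \<noteq> {}" "?A \<subseteq> H"
    using A by (auto simp: Pfin_def)
  have singletonI: "\<exists>k\<in>H. B = {k}" if "B \<in> Pfin" "\<not> Min B < Max B" for B
  proof -
    have B: "finite B" "B \<noteq> {}" "B \<subseteq> H"
      using that by (auto simp: Pfin_def)
    have "b = Min B" if "b \<in> B" for b
      using that B \<open>\<not> Min B < Max B\<close> Min_le[of B b] Max_ge[of B b] by linarith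
    then show ?thesis
      using B by blast
  qed
  have "\<not> Min ?A < Max ?A"
  proof
    assume less: "Min ?A < Max ?A"
    \<comment> \<open>The width serves as a positive element of \<open>H\<close>.\<close>
    define h where "h = Max ?A - Min ?A"
    have "Min ?A \<in> H" "Max ?A \<in> H"
      using A' Min_in[of ?A] Max_in[of ?A] by blast+
    then have h: "h \<in> H" "h > 0"
      using less by (auto simp: h_def intro: diff_closed)
    obtain e u where eu: "e \<in> carrier K" "\<psi> {0} = {e}" "u \<in> carrier K" "\<psi> {h} = {u}"
      using psi_singleton[OF zero_closed] psi_singleton[OF h(1)] by metis
    have mu: "mu e = 0" "mu u = h"
      using preimage_eqI[OF Pfin_singleton[OF zero_closed] eu(2)]
        preimage_eqI[OF Pfin_singleton[OF h(1)] eu(4)] by (simp_all add: mu_def)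
    \<comment> \<open>\<open>mu\<close> takes the values \<open>0\<close> and \<open>h\<close> on
      this pair, which makes the spread of \<open>B\<close> nonzero.\<close>
    obtain B where B: "B \<in> Pfin" "\<psi> B = {e, u}"
      using psi_surj[of "{e, u}"] eu by auto
    have B_spread: "spread B = h"
      using h by (simp add: spread_def B mu)
    have spread_singleton: "spread {k} = 0" if "k \<in> H" for k
      using psi_singleton[OF that] spread_eq_zero by blast
    \<comment> \<open>\<open>additive_eq_zero\<close> requires positive width; a singleton
      \<open>B\<close> would have spread zero.\<close>
    have "Min B < Max B"
    proof (rule ccontr)
      assume "\<not> Min B < Max B"
      then obtain k where "k \<in> H" "B = {k}"
        using singletonI B by blast
      then have "spread B = 0"
        using spread_singleton by simp
      then show False
        using B_spread h by simp
    qed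
    then have "spread B = 0"
      using additive_eq_zero[of spread ?A B, OF spread_plus spread_singleton A(1) less
          spread_eq_zero[OF A(2)] B(1)] by blast
    then show False
      using B_spread h by simp
  qed
  then show ?thesis
    using singletonI A by blast
qed

text \<open>Surjectivity is where \<open>preimage_singleton\<close> enters; the other properties are
  those of \<open>\<psi>\<close> restricted to singletons.\<close>

lemma iso_point_map:
  "(\<lambda>h. the_elem (\<psi> {h})) \<in> iso (rat_group\<lparr>carrier := H\<rparr>) K" (is "?g \<in> _")
proof -
  have g: "?g h \<in> carrier K" "\<psi> {h} = {?g h}" if "h \<in> H" for h
  proof -
    obtain x where "x \<in> carrier K" "\<psi> {h} = {x}"
      using psi_singleton[OF \<open>h \<in> H\<close>] by blast
    then show "?g h \<in> carrier K" "\<psi> {h} = {?g h}"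
      by simp_all
  qed
  have "?g (h + k) = ?g h \<otimes> ?g k" if "h \<in> H" "k \<in> H" for h k
  proof -
    have "\<psi> {h + k} = \<psi> ({h} + {k})"
      by (simp add: set_plus_def)
    also have "\<dots> = {?g h} <#> {?g k}"
      using that g(2) by (simp add: psi_plus Pfin_singleton)
    finally show ?thesis
      by (simp add: set_mult_def)
  qed
  moreover have "inj_on ?g H"
  proof (rule inj_onI)
    fix h k assume "h \<in> H" "k \<in> H" "?g h = ?g k"
    then have "\<psi> {h} = \<psi> {k}"
      using g(2) by metis
    then show "h = k"
      using psi_inj \<open>h \<in> H\<close> \<open>k \<in> H\<close> Pfin_singleton by blast
  qed
  moreover have "?g ` H = carrier K"
  proof
    show "?g ` H \<subseteq> carrier K"
      using g by blast
    show "carrier K \<subseteq> ?g ` H"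
    proof
      fix x assume x: "x \<in> carrier K"
      then obtain h where h: "h \<in> H" "preimage x = {h}"
        using preimage_singleton by blast
      then have "?g h = x"
        using preimage_props(2)[OF x] by simp
      then show "x \<in> ?g ` H"
        using h by blast
    qed
  qed
  ultimately show ?thesis
    using g(1) by (auto simp: iso_def hom_def bij_betw_def rat_group_def)
qed

end

section \<open>Translation from the record formulation to sumsets\<close>

theorem theorem1p4:
  fixes H :: "rat set" and K :: "('a, 'b) monoid_scheme"
  assumes "subgroup H rat_group"
    and "alg_semigroup K"
    and "fin_power_semigroup (rat_group\<lparr>carrier := H\<rparr>) \<cong> fin_power_semigroup K"
  shows "rat_group\<lparr>carrier := H\<rparr> \<cong> K"
proof -
  have inv: "inv\<^bsub>rat_group\<^esub> x = - x" for x
    by (rule group.inv_equality[OF group_rat_group]) (auto simp: rat_group_def)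
  interpret rat_subgroup H
    using subgroup.one_closed[OF assms(1)] subgroup.m_closed[OF assms(1)]
      subgroup.m_inv_closed[OF assms(1)]
    unfolding inv by unfold_locales (auto simp: rat_group_def)
  interpret K: alg_semigroup K by fact
  have carrier: "carrier (fin_power_semigroup (rat_group\<lparr>carrier := H\<rparr>)) = Pfin"
    by (simp add: fin_power_semigroup_def Pfin_def)
  have mult: "A \<otimes>\<^bsub>fin_power_semigroup (rat_group\<lparr>carrier := H\<rparr>)\<^esub> B = A + B" for A B
    by (auto simp: fin_power_semigroup_def set_mult_def set_plus_def rat_group_def)
  obtain \<psi> where "\<psi> \<in> iso (fin_power_semigroup (rat_group\<lparr>carrier := H\<rparr>)) (fin_power_semigroup K)"
    using assms(3) by (auto simp: is_iso_def)
  then have "bij_betw \<psi> Pfin (carrier (fin_power_semigroup K))"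
    and "\<And>A B. \<lbrakk>A \<in> Pfin; B \<in> Pfin\<rbrakk> \<Longrightarrow> \<psi> (A + B) = \<psi> A <#>\<^bsub>K\<^esub> \<psi> B"
    by (auto simp: iso_def hom_def carrier mult) (auto simp: fin_power_semigroup_def)
  then interpret fin_power_iso H K \<psi>
    by unfold_locales
  show ?thesis
    using iso_point_map by (auto simp: is_iso_def)
qed

end
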